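(* Let $n\ge5$ and let $G$ be the $n\times n$ toroidal chess graph. Play Cops and Robbers on $G$ with every cop moving as a knight and the robber moving on foot. Then $c(G)=3$.
   Context: The $n\times n$ toroidal chess graph has vertex set $\mathbb{Z}_n\times\mathbb{Z}_n$, where $(i,j)$ is row $i$, column $j$; indices are taken mod $n$. Two vertices are adjacent if they differ by $\pm1$ in exactly one coordinate and agree in the other. Cops and Robbers with one robber is played as follows. The $k$ cops choose starting vertices (several cops may share a vertex), then the robber chooses a starting vertex. After that the cops and the robber alternate turns, cops first. On the cops' turn, each cop either stays where it is or moves to one of its allowable vertices. On the robber's turn, the robber either stays or moves to one of his allowable vertices. The cops win if, after finitely many moves, some cop occupies the robber's vertex. The robber wins if he can guarantee that this never happens. A player on foot at $(i,j)$ has as allowable vertices the four vertices adjacent to $(i,j)$. A player moving as a knight at $(i,j)$ has as allowable vertices $(i\pm1,j\pm2)$ and $(i\pm2,j\pm1)$ (all sign choices, mod $n$). The cop number $c(G)$ is the minimum number of cops for which the cops have a winning strategy, whatever the robber's starting position. *)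

theory Defs
  imports Main
begin

text \<open>
  Cops and Robbers on a vertex set \<open>V\<close>. The allowable vertices of a cop and of the robber are
  given by two independent functions \<open>C\<close> and \<open>R\<close>.
\<close>

definition legal_turn :: "('v \<Rightarrow> 'v set) \<Rightarrow> 'v \<Rightarrow> 'v \<Rightarrow> bool" where
  "legal_turn A u v \<longleftrightarrow> v = u \<or> v \<in> A u"

definition robber_walk :: "'v set \<Rightarrow> ('v \<Rightarrow> 'v set) \<Rightarrow> (nat \<Rightarrow> 'v) \<Rightarrow> bool" where
  "robber_walk V R r \<longleftrightarrow> r 0 \<in> V \<and> (\<forall>t. legal_turn R (r t) (r (Suc t)))"

text \<open>
  A strategy maps the list of all robber positions so far, oldest first, to the cops' positions:
  \<open>S []\<close> is the starting placement, chosen before the robber's, and \<open>S [r 0, ..., r t]\<close> is the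
  placement after the cops have answered \<open>r t\<close>. Since the cops' own earlier positions are
  determined by \<open>S\<close>, this is a strategy with full memory. Cop \<open>i\<close>, for \<open>i < k\<close>, stands at
  \<open>S h i\<close>; values at \<open>i \<ge> k\<close> are irrelevant. Plays are continued formally after a capture,
  which is harmless because staying put is always legal.
\<close>

definition cop_strategy ::
  "'v set \<Rightarrow> ('v \<Rightarrow> 'v set) \<Rightarrow> ('v \<Rightarrow> 'v set) \<Rightarrow> nat \<Rightarrow> ('v list \<Rightarrow> nat \<Rightarrow> 'v) \<Rightarrow> bool" where
  "cop_strategy V C R k S \<longleftrightarrow>
     (\<forall>i<k. S [] i \<in> V) \<and>
     (\<forall>r. robber_walk V R r \<longrightarrow>
        (\<forall>t. \<forall>i<k. legal_turn C (S (map r [0..<t]) i) (S (map r [0..<Suc t]) i)))"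

text \<open>
  The two disjuncts are the positions just after the robber has arrived at \<open>r t\<close> and just
  after the cops' following turn.
\<close>

definition captures :: "nat \<Rightarrow> ('v list \<Rightarrow> nat \<Rightarrow> 'v) \<Rightarrow> (nat \<Rightarrow> 'v) \<Rightarrow> bool" where
  "captures k S r \<longleftrightarrow>
     (\<exists>t. \<exists>i<k. S (map r [0..<t]) i = r t \<or> S (map r [0..<Suc t]) i = r t)"

definition cops_win :: "'v set \<Rightarrow> ('v \<Rightarrow> 'v set) \<Rightarrow> ('v \<Rightarrow> 'v set) \<Rightarrow> nat \<Rightarrow> bool" where
  "cops_win V C R k \<longleftrightarrow>
     (\<exists>S. cop_strategy V C R k S \<and> (\<forall>r. robber_walk V R r \<longrightarrow> captures k S r))"

definition cop_number :: "'v set \<Rightarrow> ('v \<Rightarrow> 'v set) \<Rightarrow> ('v \<Rightarrow> 'v set) \<Rightarrow> nat" where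
  "cop_number V C R = (LEAST k. cops_win V C R k)"

text \<open>On a finite vertex set some number of cops wins, so the minimum exists.\<close>

lemma cops_win_card:
  assumes "finite V"
  shows "cops_win V C R (card V)"
proof -
  obtain f where f: "bij_betw f {0..<card V} V"
    using ex_bij_betw_nat_finite[OF assms] by blast
  have "cop_strategy V C R (card V) (\<lambda>_. f)"
    using bij_betwE[OF f] by (auto simp: cop_strategy_def legal_turn_def)
  moreover have "captures (card V) (\<lambda>_. f) r" if "robber_walk V R r" for r
  proof -
    have "r 0 \<in> f ` {0..<card V}"
      using that f by (simp add: robber_walk_def bij_betw_def)
    then obtain i where "i < card V" "f i = r 0"
      by (metis atLeastLessThan_iff imageE)
    then show ?thesis unfolding captures_def by blast
  qed
  ultimately show ?thesis unfolding cops_win_def by blast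
qed

lemma cops_win_cop_number:
  assumes "finite V"
  shows "cops_win V C R (cop_number V C R)"
  unfolding cop_number_def using cops_win_card[OF assms] by (rule LeastI)

text \<open>The torus: residues mod \<open>n\<close> are represented by \<open>{0..<n}\<close>.\<close>

definition torus_verts :: "nat \<Rightarrow> (int \<times> int) set" where
  "torus_verts n = {0..<int n} \<times> {0..<int n}"

definition differ_by_one :: "nat \<Rightarrow> int \<Rightarrow> int \<Rightarrow> bool" where
  "differ_by_one n a b \<longleftrightarrow> b mod int n = (a + 1) mod int n \<or> b mod int n = (a - 1) mod int n"

definition torus_adj :: "nat \<Rightarrow> int \<times> int \<Rightarrow> int \<times> int \<Rightarrow> bool" where
  "torus_adj n u v \<longleftrightarrow> u \<in> torus_verts n \<and> v \<in> torus_verts n \<and>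
     (fst u = fst v \<and> differ_by_one n (snd u) (snd v) \<or>
      differ_by_one n (fst u) (fst v) \<and> snd u = snd v)"

definition foot_moves :: "nat \<Rightarrow> int \<times> int \<Rightarrow> (int \<times> int) set" where
  "foot_moves n u = {v. torus_adj n u v}"

definition knight_moves :: "nat \<Rightarrow> int \<times> int \<Rightarrow> (int \<times> int) set" where
  "knight_moves n u =
     {((fst u + a) mod int n, (snd u + b) mod int n) | a b.
        a \<in> {1, -1} \<and> b \<in> {2, -2} \<or> a \<in> {2, -2} \<and> b \<in> {1, -1}}"

end

theory Submission
  imports Defs "HOL-Library.Product_Plus"
begin

text \<open>
  Two knights never suffice: a knight that is not on the robber's square reaches at most two of the
  five squares of the robber's closed neighbourhood, so one of the five is safe.

  Three knights win already on the infinite board, of which the torus is a quotient. In coordinates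
  relative to the robber, a knight outside the ring of the eight squares around the robber can
  decrease its distance in the maximum norm in each round, and a knight on the ring can stay there.
  Two knights on the ring can reach opposite corners of it. Then they attack all four neighbours of
  the robber, who has to stay while the third knight walks up to him.
\<close>

section \<open>Winning and losing criteria\<close>

text \<open>The cops are to move, and \<open>m\<close> bounds the number of turns they still get;
  the bound makes the predicate recursive. Legality is asked of every index, also from
  \<open>k\<close> on, where staying put serves.\<close>

primrec cops_catch ::
  "('v \<Rightarrow> 'v set) \<Rightarrow> ('v \<Rightarrow> 'v set) \<Rightarrow> nat \<Rightarrow> nat \<Rightarrow> (nat \<Rightarrow> 'v) \<Rightarrow> 'v \<Rightarrow> bool" where
  "cops_catch C R k 0 c r \<longleftrightarrow> False"
| "cops_catch C R k (Suc m) c r \<longleftrightarrow>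
     (\<exists>c'. (\<forall>i. legal_turn C (c i) (c' i)) \<and>
        ((\<exists>i<k. c' i = r) \<or> (\<forall>r'. legal_turn R r r' \<longrightarrow> cops_catch C R k m c' r')))"

lemma cops_catch_mono:
  assumes "cops_catch C R k m c r" "m \<le> m'"
  shows "cops_catch C R k m' c r"
  using assms
proof (induction m arbitrary: m' c r)
  case (Suc m)
  obtain m'' where "m' = Suc m''" "m \<le> m''"
    using Suc.prems(2) by (cases m') auto
  with Suc show ?case by (simp, blast)
qed simp

lemma cops_catch_if_occupied:
  assumes "i < k" "c i = r"
  shows "cops_catch C R k (Suc 0) c r"
  unfolding cops_catch.simps using assms
  by (intro exI[of _ c]) (auto simp: legal_turn_def)

text \<open>A positional win becomes a strategy by always moving so that the guaranteed number of
  remaining turns is least. This number drops in every round, so a capture must occur.\<close>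

lemma cops_win_if_catch:
  assumes c0: "\<And>i. i < k \<Longrightarrow> c0 i \<in> V"
    and catch: "\<And>r. r \<in> V \<Longrightarrow> \<exists>m. cops_catch C R k m c0 r"
  shows "cops_win V C R k"
proof -
  define good where "good = (\<lambda>m c r c'. (\<forall>i. legal_turn C (c i) (c' i)) \<and>
        ((\<exists>i<k. c' i = r) \<or> (\<forall>r'. legal_turn R r r' \<longrightarrow> cops_catch C R k m c' r')))"
  \<comment> \<open>Among the good moves one with the least bound is chosen. Where no good move
    exists the cops stay, so that \<open>F\<close> is legal at every position.\<close>
  define F where "F = (\<lambda>c r. if \<exists>m c'. good m c r c'
      then (SOME c'. good (LEAST m. \<exists>c'. good m c r c') c r c') else c)"
  have F: "good (LEAST m. \<exists>c'. good m c r c') c r (F c r)" if "good m c r c'" for m c r c'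
  proof -
    have ex: "\<exists>m c'. good m c r c'" using that by blast
    have "good (LEAST m. \<exists>c'. good m c r c') c r
        (SOME c'. good (LEAST m. \<exists>c'. good m c r c') c r c')"
      using LeastI_ex[OF ex] by (rule someI_ex)
    then show ?thesis unfolding F_def if_P[OF ex] .
  qed
  have F_legal: "legal_turn C (c i) (F c r i)" for c r i
  proof (cases "\<exists>m c'. good m c r c'")
    case True
    then show ?thesis using F unfolding good_def by blast
  next
    case False
    then have "F c r = c" unfolding F_def by (rule if_not_P)
    then show ?thesis by (simp add: legal_turn_def)
  qed
  \<comment> \<open>Folding \<open>F\<close> over the robber's history recovers the cops' current
    position from that history alone.\<close>
  define S where "S = foldl F c0"
  have S_Suc: "S (map r [0..<Suc t]) = F (S (map r [0..<t])) (r t)" for r t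
    by (simp add: S_def)
  have "cop_strategy V C R k S"
    unfolding cop_strategy_def S_Suc using c0 F_legal by (simp add: S_def)
  moreover have "captures k S r" if r: "robber_walk V R r" for r
  proof -
    have "captures k S r" if "cops_catch C R k m (S (map r [0..<t])) (r t)" for m t
      using that
    proof (induction m arbitrary: t rule: less_induct)
      case (less m)
      define l where "l = (LEAST m. \<exists>c'. good m (S (map r [0..<t])) (r t) c')"
      obtain m1 c' where m: "m = Suc m1" and c': "good m1 (S (map r [0..<t])) (r t) c'"
        using less.prems by (cases m) (auto simp: good_def)
      \<comment> \<open>The move made by \<open>F\<close> need not be \<open>c'\<close>, but by
        minimality its bound \<open>l\<close> is at most \<open>m1\<close>, hence below
        \<open>m\<close>.\<close>
      have "l \<le> m1" unfolding l_def using c' by (intro Least_le) blast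
      have "good l (S (map r [0..<t])) (r t) (S (map r [0..<Suc t]))"
        unfolding S_Suc l_def using F[OF c'] .
      then consider "\<exists>i<k. S (map r [0..<Suc t]) i = r t"
        | "cops_catch C R k l (S (map r [0..<Suc t])) (r (Suc t))"
        using r unfolding good_def robber_walk_def by blast
      then show ?case
      proof cases
        case 1
        then show ?thesis unfolding captures_def by blast
      next
        case 2
        then show ?thesis using less.IH[of l "Suc t"] \<open>l \<le> m1\<close> m by simp
      qed
    qed
    moreover have "\<exists>m. cops_catch C R k m (S (map r [0..<0])) (r 0)"
      using catch r by (simp add: S_def robber_walk_def)
    ultimately show ?thesis by blast
  qed
  ultimately show ?thesis unfolding cops_win_def by blast
qed

text \<open>The cops play upstairs against a lift of the robber: his moves lift along
  \<open>p\<close>, their answers project back, and a capture upstairs projects to a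
  capture.\<close>

lemma cops_catch_project:
  assumes cop: "\<And>u v. legal_turn C u v \<Longrightarrow> legal_turn C' (p u) (p v)"
    and robber: "\<And>u v'. legal_turn R' (p u) v' \<Longrightarrow> \<exists>v. legal_turn R u v \<and> p v = v'"
    and "cops_catch C R k m c r"
  shows "cops_catch C' R' k m (\<lambda>i. p (c i)) (p r)"
  using assms(3)
proof (induction m arbitrary: c r)
  case (Suc m)
  obtain c' where c': "\<And>i. legal_turn C (c i) (c' i)"
    and next': "(\<exists>i<k. c' i = r) \<or> (\<forall>r'. legal_turn R r r' \<longrightarrow> cops_catch C R k m c' r')"
    using Suc.prems by auto
  have "(\<exists>i<k. p (c' i) = p r) \<or>
      (\<forall>r'. legal_turn R' (p r) r' \<longrightarrow> cops_catch C' R' k m (\<lambda>i. p (c' i)) r')"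
    using next' Suc.IH robber by metis
  then show ?case
    using cop[OF c'] by (auto intro!: exI[of _ "\<lambda>i. p (c' i)"])
qed simp

text \<open>The robber keeps the invariant that after his move no cop can reach him. The cops' next
  turn then leaves him uncaught, which is what \<open>evade\<close> needs to restore the
  invariant.\<close>

lemma not_cops_win_if_evade:
  assumes closed: "\<And>u v. u \<in> V \<Longrightarrow> legal_turn C u v \<Longrightarrow> v \<in> V"
    and R_closed: "\<And>u v. u \<in> V \<Longrightarrow> legal_turn R u v \<Longrightarrow> v \<in> V"
    and start: "\<And>c. \<exists>r\<in>V. \<forall>i<k. c i \<noteq> r"
    and evade: "\<And>c r. \<lbrakk>r \<in> V; \<And>i. i < k \<Longrightarrow> c i \<in> V; \<And>i. i < k \<Longrightarrow> c i \<noteq> r\<rbrakk>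
      \<Longrightarrow> \<exists>r'. legal_turn R r r' \<and> (\<forall>i<k. \<not> legal_turn C (c i) r')"
  shows "\<not> cops_win V C R k"
proof
  assume "cops_win V C R k"
  then obtain S where S: "cop_strategy V C R k S"
    and win: "\<And>r. robber_walk V R r \<Longrightarrow> captures k S r"
    unfolding cops_win_def by blast
  define safe where "safe = (\<lambda>c r r'. legal_turn R r r' \<and> (\<forall>i<k. \<not> legal_turn C (c i) r'))"
  define nxt where "nxt = (\<lambda>c r. if \<exists>r'. safe c r r' then SOME r'. safe c r r' else r)"
  have nxt: "safe c r (nxt c r)" if "\<exists>r'. safe c r r'" for c r
    using someI_ex[OF that] that by (simp add: nxt_def)
  have nxt_legal: "legal_turn R r (nxt c r)" for c r
  proof (cases "\<exists>r'. safe c r r'")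
    case True
    then show ?thesis using nxt unfolding safe_def by blast
  next
    case False
    then show ?thesis by (auto simp: nxt_def legal_turn_def)
  qed
  have nxt_safe: "\<forall>i<k. \<not> legal_turn C (c i) (nxt c r)"
    if "r \<in> V" "\<And>i. i < k \<Longrightarrow> c i \<in> V" "\<And>i. i < k \<Longrightarrow> c i \<noteq> r" for c r
    using nxt[of c r] evade[of r c] that unfolding safe_def by blast
  obtain r0 where r0: "r0 \<in> V" "\<forall>i<k. S [] i \<noteq> r0" using start by blast
  \<comment> \<open>\<open>h t\<close> is the list of the first \<open>t\<close> robber positions.
    The unoccupied vertex \<open>r0\<close> acts as a virtual position before the start, so that
    \<open>evade\<close> already makes the real starting vertex \<open>r 0\<close> safe.\<close>
  define h where "h = rec_nat [] (\<lambda>_ l. l @ [nxt (S l) (if l = [] then r0 else last l)])"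
  define r where "r = (\<lambda>t. last (h (Suc t)))"
  have h_Suc: "h (Suc t) = h t @ [nxt (S (h t)) (if h t = [] then r0 else last (h t))]" for t
    by (simp add: h_def)
  have h: "h t = map r [0..<t]" for t
  proof (induction t)
    case 0
    show ?case by (simp add: h_def)
  next
    case (Suc t)
    have "h (Suc t) = h t @ [r t]" by (simp add: r_def h_Suc)
    then show ?case using Suc by simp
  qed
  have r_0: "r 0 = nxt (S []) r0"
    by (simp add: r_def h_Suc) (simp add: h_def)
  have r_Suc: "r (Suc t) = nxt (S (map r [0..<Suc t])) (r t)" for t
    unfolding h[symmetric] by (simp add: r_def h_Suc)
  have r_V: "r t \<in> V" for t
    by (induction t) (use r0 R_closed nxt_legal in \<open>auto simp: r_0 r_Suc simp del: upt_Suc\<close>)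
  have walk: "robber_walk V R r"
    unfolding robber_walk_def using r_V nxt_legal r_Suc by metis
  have S_0: "S [] i \<in> V" if "i < k" for i
    using S that unfolding cop_strategy_def by blast
  have S_legal: "legal_turn C (S (map r [0..<t]) i) (S (map r [0..<Suc t]) i)" if "i < k" for t i
    using S walk that unfolding cop_strategy_def by blast
  have S_V: "S (map r [0..<t]) i \<in> V" if "i < k" for t i
  proof (induction t)
    case 0
    show ?case using S_0[OF that] by simp
  next
    case (Suc t)
    show ?case by (rule closed[OF Suc S_legal[OF that]])
  qed
  have safe: "\<forall>i<k. \<not> legal_turn C (S (map r [0..<t]) i) (r t)" for t
  proof (induction t)
    case 0
    show ?case using nxt_safe[of r0 "S []"] r0 S_0 by (simp add: r_0)
  next
    case (Suc t)
    have "S (map r [0..<Suc t]) i \<noteq> r t" if "i < k" for i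
      using S_legal[OF that, of t] Suc that by metis
    then show ?case
      unfolding r_Suc[of t] by (intro nxt_safe r_V S_V)
  qed
  have "\<not> captures k S r"
    unfolding captures_def using safe S_legal by (metis legal_turn_def)
  with win[OF walk] show False by simp
qed

section \<open>Three knights on the infinite board\<close>

text \<open>Steps are kept as lists so that quantifiers over them can be evaluated in the finite
  case checks.\<close>

definition knight_steps :: "(int \<times> int) list" where
  "knight_steps = [(1, 2), (1, -2), (-1, 2), (-1, -2), (2, 1), (2, -1), (-2, 1), (-2, -1)]"

definition foot_steps :: "(int \<times> int) list" where
  "foot_steps = [(1, 0), (-1, 0), (0, 1), (0, -1)]"

definition plane_moves :: "(int \<times> int) list \<Rightarrow> int \<times> int \<Rightarrow> (int \<times> int) set" where
  "plane_moves D u = {u + d | d. d \<in> set D}"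

abbreviation plane_turn :: "(int \<times> int) list \<Rightarrow> int \<times> int \<Rightarrow> int \<times> int \<Rightarrow> bool" where
  "plane_turn D \<equiv> legal_turn (plane_moves D)"

lemma plane_turn_iff: "plane_turn D u v \<longleftrightarrow> v - u \<in> set ((0, 0) # D)"
proof -
  have "(\<exists>d. v = u + d \<and> d \<in> set D) \<longleftrightarrow> v - u \<in> set D"
    by (metis add_diff_cancel_left' add.commute diff_add_cancel)
  then show ?thesis
    by (simp add: legal_turn_def plane_moves_def zero_prod_def[symmetric])
qed

lemma plane_turn_translate: "plane_turn D (w + u) (w + v) \<longleftrightarrow> plane_turn D u v"
  by (simp add: plane_turn_iff)

text \<open>Every index from 2 on receives \<open>z\<close>, so three legal moves give legality at
  all indices, as \<open>cops_catch\<close> demands.\<close>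

definition triple :: "'a \<Rightarrow> 'a \<Rightarrow> 'a \<Rightarrow> nat \<Rightarrow> 'a" where
  "triple x y z i = (if i = 0 then x else if i = 1 then y else z)"

text \<open>Robber to move; \<open>x\<close>, \<open>y\<close>, \<open>z\<close> are the positions of the cops relative to the robber.\<close>

definition winning :: "int \<times> int \<Rightarrow> int \<times> int \<Rightarrow> int \<times> int \<Rightarrow> bool" where
  "winning x y z \<longleftrightarrow> (\<forall>r r'. plane_turn foot_steps r r' \<longrightarrow>
     (\<exists>m. cops_catch (plane_moves knight_steps) (plane_moves foot_steps) 3 m
        (triple (r + x) (r + y) (r + z)) r'))"

text \<open>When the robber steps by \<open>e\<close>, a cop at relative position \<open>x\<close>
  is shifted to \<open>x - e\<close>; from there it answers.\<close>

definition reply :: "int \<times> int \<Rightarrow> int \<times> int \<Rightarrow> int \<times> int \<Rightarrow> bool" where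
  "reply e x x' \<longleftrightarrow> plane_turn knight_steps (x - e) x'"

lemma reply_iff: "reply e x x' \<longleftrightarrow> x' - (x - e) \<in> set ((0, 0) # knight_steps)"
  by (simp only: reply_def plane_turn_iff)

lemma reply_add:
  assumes "k \<in> set ((0, 0) # knight_steps)"
  shows "reply e x (x - e + k)" "reply 0 x (x + k)"
  using assms by (simp_all add: reply_iff)

lemma reply_stay: "reply e x (x - e)" "reply 0 x x"
  by (simp_all add: reply_iff zero_prod_def)

text \<open>One round of the game in relative coordinates, justified by the translation invariance
  of the moves.\<close>

lemma winningI:
  assumes "\<And>e. e \<in> set ((0, 0) # foot_steps) \<Longrightarrow>
    \<exists>x' y' z'. reply e x x' \<and> reply e y y' \<and> reply e z z' \<and>
      (x' = 0 \<or> y' = 0 \<or> z' = 0 \<or> winning x' y' z')"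
  shows "winning x y z"
  unfolding winning_def
proof (intro allI impI)
  fix r r' :: "int \<times> int"
  assume "plane_turn foot_steps r r'"
  then have "r' - r \<in> set ((0, 0) # foot_steps)" by (simp only: plane_turn_iff)
  then obtain x' y' z' where
    reply: "reply (r' - r) x x'" "reply (r' - r) y y'" "reply (r' - r) z z'" and
    result: "x' = 0 \<or> y' = 0 \<or> z' = 0 \<or> winning x' y' z'"
    using assms by blast
  let ?C = "plane_moves knight_steps" and ?R = "plane_moves foot_steps"
  let ?c = "triple (r + x) (r + y) (r + z)" and ?c' = "triple (r' + x') (r' + y') (r' + z')"
  have turn: "legal_turn ?C (r + u) (r' + u')" if "reply (r' - r) u u'" for u u'
    using that plane_turn_translate[of _ r' "u - (r' - r)" u'] by (simp add: reply_def algebra_simps)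
  have legal: "legal_turn ?C (?c i) (?c' i)" for i
    using reply turn by (simp add: triple_def)
  show "\<exists>m. cops_catch ?C ?R 3 m ?c r'"
  proof (cases "winning x' y' z'")
    case True
    \<comment> \<open>The bounds in \<open>winning\<close> may depend on the robber's move. He has
      finitely many moves, so their maximum is a common bound.\<close>
    have fin: "finite {r''. legal_turn ?R r' r''}"
      by (rule finite_subset[of _ "insert r' ((+) r' ` set foot_steps)"])
        (auto simp: legal_turn_def plane_moves_def)
    obtain f where f: "\<And>r''. legal_turn ?R r' r'' \<Longrightarrow> cops_catch ?C ?R 3 (f r'') ?c' r''"
      using True unfolding winning_def by metis
    have "cops_catch ?C ?R 3 (Max (f ` {r''. legal_turn ?R r' r''})) ?c' r''"
      if "legal_turn ?R r' r''" for r''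
      using f[OF that] by (rule cops_catch_mono) (use fin that in simp)
    then have "cops_catch ?C ?R 3 (Suc (Max (f ` {r''. legal_turn ?R r' r''}))) ?c r'"
      using legal by (auto intro!: exI[of _ ?c'])
    then show ?thesis ..
  next
    case False
    then have "?c' 0 = r' \<or> ?c' 1 = r' \<or> ?c' 2 = r'"
      using result by (auto simp: triple_def)
    then have "\<exists>i<3. ?c' i = r'"
      by (elim disjE) (rule exI, rule conjI[rotated], assumption, simp)+
    then have "cops_catch ?C ?R 3 (Suc 0) ?c r'"
      unfolding cops_catch.simps using legal by blast
    then show ?thesis ..
  qed
qed

section \<open>Approaching the robber in the maximum norm\<close>

definition sup_norm :: "int \<times> int \<Rightarrow> int" where
  "sup_norm x = max \<bar>fst x\<bar> \<bar>snd x\<bar>"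

lemma sup_norm_eq_0_iff: "sup_norm x = 0 \<longleftrightarrow> x = 0"
  by (auto simp: sup_norm_def prod_eq_iff max_def split: if_splits)

lemma sup_norm_nonneg: "0 \<le> sup_norm x"
  by (simp add: sup_norm_def)

text \<open>From afar the knight moves two squares towards the robber in its larger coordinate and
  one in the other, which outweighs his single step. Near him, nine positions and five steps are
  checked.\<close>

lemma approach:
  assumes e: "e \<in> set ((0, 0) # foot_steps)"
  shows "\<exists>x'. reply e x x' \<and> sup_norm x' \<le> max 1 (sup_norm x - 1)"
proof (cases "sup_norm x \<le> 1")
  case True
  have "\<forall>a \<in> set [-1, 0, 1]. \<forall>b \<in> set [-1, 0, 1]. \<forall>e \<in> set ((0, 0) # foot_steps).
      \<exists>k \<in> set ((0, 0) # knight_steps). sup_norm ((a, b) - e + k) \<le> 1"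
    by code_simp
  moreover have "fst x \<in> set [-1, 0, 1]" "snd x \<in> set [-1, 0, 1]"
    using True by (auto simp: sup_norm_def)
  ultimately obtain k where k_step: "k \<in> set ((0, 0) # knight_steps)"
    and k: "sup_norm ((fst x, snd x) - e + k) \<le> 1"
    using e by blast
  have "reply e x (x - e + k)" using k_step by (rule reply_add)
  then show ?thesis using k by (intro exI[of _ "x - e + k"]) simp
next
  case False
  define a b where "a = fst (x - e)" and "b = snd (x - e)"
  \<comment> \<open>A zero coordinate counts as negative and is pushed to absolute value 1 or 2. The
    value 1 is harmless since the norm of \<open>x\<close> is at least 2.\<close>
  define s t :: int where "s = (if a > 0 then 1 else -1)" and "t = (if b > 0 then 1 else -1)"
  define k where "k = (if \<bar>b\<bar> \<le> \<bar>a\<bar> then (- 2 * s, - t) else (- s, - 2 * t))"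
  have "k \<in> set knight_steps"
    by (auto simp: knight_steps_def k_def s_def t_def)
  then have "reply e x (x - e + k)" by (intro reply_add) simp
  moreover have "sup_norm (x - e + k) \<le> sup_norm x - 1"
  proof -
    define N where "N = sup_norm x"
    have "\<bar>fst x\<bar> \<le> N" "\<bar>snd x\<bar> \<le> N" by (simp_all add: N_def sup_norm_def)
    then have ab: "\<bar>a\<bar> \<le> N + 1" "\<bar>b\<bar> \<le> N + 1" "\<bar>a\<bar> \<le> N \<or> \<bar>b\<bar> \<le> N"
      using e by (auto simp: a_def b_def foot_steps_def)
    \<comment> \<open>Together with \<open>2 \<le> N\<close> this excludes \<open>a = b = 0\<close>,
      where the knight would have to jump away from the robber.\<close>
    have far: "N \<le> \<bar>a\<bar> + 1 \<or> N \<le> \<bar>b\<bar> + 1"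
      using e by (auto simp: N_def sup_norm_def a_def b_def foot_steps_def)
    have N: "2 \<le> N" using False by (simp add: N_def)
    have "\<bar>a + fst k\<bar> \<le> N - 1 \<and> \<bar>b + snd k\<bar> \<le> N - 1"
      using ab far N unfolding k_def s_def t_def by (auto split: if_splits)
    then show ?thesis by (simp add: sup_norm_def N_def a_def b_def)
  qed
  ultimately show ?thesis by (metis max.coboundedI2)
qed

section \<open>Two knights on the ring around the robber\<close>

definition ring :: "(int \<times> int) list" where
  "ring = [(1, 0), (-1, 0), (0, 1), (0, -1), (1, 1), (1, -1), (-1, 1), (-1, -1)]"

lemma sup_norm_eq_1_iff: "sup_norm x = 1 \<longleftrightarrow> x \<in> set ring"
proof
  assume x: "sup_norm x = 1"
  then have "fst x \<in> {-1, 0, 1}" "snd x \<in> {-1, 0, 1}"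
    by (auto simp: sup_norm_def)
  with x show "x \<in> set ring"
    by (cases x) (auto simp: sup_norm_def ring_def)
qed (auto simp: sup_norm_def ring_def)

definition opposite_corners :: "int \<times> int \<Rightarrow> int \<times> int \<Rightarrow> bool" where
  "opposite_corners x y \<longleftrightarrow> \<bar>fst x\<bar> = 1 \<and> \<bar>snd x\<bar> = 1 \<and> x + y = (0, 0)"

text \<open>A count of rounds still needed at most to reach opposite corners: coinciding knights
  separate, separate ones become orthogonally adjacent, adjacent ones take opposite corners. Stages
  may be skipped.\<close>

definition pair_rank :: "int \<times> int \<Rightarrow> int \<times> int \<Rightarrow> nat" where
  "pair_rank x y =
     (if opposite_corners x y then 0
      else if \<bar>fst x - fst y\<bar> + \<bar>snd x - snd y\<bar> = 1 then 1
      else if x \<noteq> y then 2 else 3)"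

text \<open>Cops at opposite corners attack all four neighbours of the robber, so he has to stay.\<close>

lemma winning_frozen_step:
  assumes xy: "opposite_corners x y"
    and z: "reply 0 z z'" "z' = 0 \<or> winning x y z'"
  shows "winning x y z"
proof (rule winningI)
  fix e assume e: "e \<in> set ((0, 0) # foot_steps)"
  show "\<exists>x' y' z'. reply e x x' \<and> reply e y y' \<and> reply e z z' \<and>
      (x' = 0 \<or> y' = 0 \<or> z' = 0 \<or> winning x' y' z')"
  proof (cases "e = 0")
    case True
    then show ?thesis using z reply_stay(2) by blast
  next
    case False
    have "x \<in> set ring" "y = - x"
      using xy by (auto simp: opposite_corners_def sup_norm_eq_1_iff[symmetric] sup_norm_def
          zero_prod_def[symmetric] eq_neg_iff_add_eq_0 add.commute)
    moreover have "e \<in> set foot_steps" using e False by (auto simp: zero_prod_def)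
    moreover have "\<forall>x \<in> set ring. opposite_corners x (- x) \<longrightarrow> (\<forall>e \<in> set foot_steps.
        - (x - e) \<in> set knight_steps \<or> - (- x - e) \<in> set knight_steps)"
      by code_simp
    ultimately have "- (x - e) \<in> set knight_steps \<or> - (y - e) \<in> set knight_steps"
      using xy by blast
    then have "reply e x 0 \<or> reply e y 0" by (auto simp: reply_iff)
    then show ?thesis using reply_stay(1) by blast
  qed
qed

text \<open>Against a robber who has to stay, the third knight comes nearer by
  \<open>approach\<close> until it is on the ring, where that lemma gives no further progress and
  explicit moves finish.\<close>

lemma winning_frozen:
  assumes xy: "opposite_corners x y"
  shows "winning x y z"
proof (induction "nat (sup_norm z)" arbitrary: z rule: less_induct)
  case less
  note step = winning_frozen_step[OF xy]
  consider "z = 0" | "sup_norm z = 1" | "sup_norm z \<ge> 2"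
    using sup_norm_nonneg[of z] sup_norm_eq_0_iff[of z] by linarith
  then show ?case
  proof cases
    case 1
    then show ?thesis using step reply_stay(2) by blast
  next
    case 2
    \<comment> \<open>Three turns, passes included, lead from any ring square to the centre. The win
      is then propagated backwards from the last turn to the first.\<close>
    have "\<forall>z \<in> set ring. \<exists>k \<in> set ((0, 0) # knight_steps).
        \<exists>l \<in> set ((0, 0) # knight_steps). \<exists>m \<in> set ((0, 0) # knight_steps).
        z + k + l + m = (0, 0)"
      by code_simp
    then obtain k l m where klm: "k \<in> set ((0, 0) # knight_steps)"
      "l \<in> set ((0, 0) # knight_steps)" "m \<in> set ((0, 0) # knight_steps)"
      and "z + k + l + m = 0"
      using 2 unfolding sup_norm_eq_1_iff zero_prod_def by blast
    then have "winning x y (z + k + l)"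
      using step reply_add(2)[OF klm(3)] by metis
    then have "winning x y (z + k)" using step reply_add(2)[OF klm(2)] by blast
    then show ?thesis using step reply_add(2)[OF klm(1)] by blast
  next
    case 3
    obtain z' where "reply 0 z z'" "sup_norm z' \<le> max 1 (sup_norm z - 1)"
      using approach[of 0 z] by (auto simp: zero_prod_def)
    then show ?thesis using less[of z'] step 3 by simp
  qed
qed

text \<open>In each round the two knights capture or stay on the ring with smaller
  \<open>pair_rank\<close>, until \<open>winning_frozen\<close> applies. Meanwhile the third knight
  stands still.\<close>

lemma winning_ring:
  assumes "x \<in> set ring" "y \<in> set ring"
  shows "winning x y z"
  using assms
proof (induction "pair_rank x y" arbitrary: x y z rule: less_induct)
  case (less x y z)
  show ?case
  proof (cases "opposite_corners x y")
    case True
    then show ?thesis by (rule winning_frozen)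
  next
    case False
    show ?thesis
    proof (rule winningI)
      fix e assume e: "e \<in> set ((0, 0) # foot_steps)"
      \<comment> \<open>A capture by the first knight settles the round, so a move of the second is
        sought only when the first remains on the ring.\<close>
      have "\<forall>x \<in> set ring. \<forall>y \<in> set ring. \<forall>e \<in> set ((0, 0) # foot_steps).
          opposite_corners x y \<or>
          (\<exists>k \<in> set ((0, 0) # knight_steps). x - e + k = (0, 0) \<or> x - e + k \<in> set ring \<and>
            (\<exists>l \<in> set ((0, 0) # knight_steps). y - e + l = (0, 0) \<or> y - e + l \<in> set ring \<and>
              pair_rank (x - e + k) (y - e + l) < pair_rank x y))"
        by code_simp
      then have "\<exists>k \<in> set ((0, 0) # knight_steps). x - e + k = 0 \<or> x - e + k \<in> set ring \<and>
            (\<exists>l \<in> set ((0, 0) # knight_steps). y - e + l = 0 \<or> y - e + l \<in> set ring \<and>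
              pair_rank (x - e + k) (y - e + l) < pair_rank x y)"
        using less.prems e False unfolding zero_prod_def by blast
      then consider k where "reply e x (x - e + k)" "x - e + k = 0"
        | k l where "reply e x (x - e + k)" "reply e y (y - e + l)" "x - e + k \<in> set ring"
          "y - e + l = 0 \<or> y - e + l \<in> set ring \<and>
            pair_rank (x - e + k) (y - e + l) < pair_rank x y"
        using reply_add(1) by blast
      then show "\<exists>x' y' z'. reply e x x' \<and> reply e y y' \<and> reply e z z' \<and>
          (x' = 0 \<or> y' = 0 \<or> z' = 0 \<or> winning x' y' z')"
      proof cases
        case 1
        then show ?thesis using reply_stay(1) by blast
      next
        case 2
        then show ?thesis using reply_stay(1) less.hyps by blast
      qed
    qed
  qed
qed

section \<open>The full strategy on the infinite board\<close>

text \<open>Two knights approach at once. Both norms are at least 1, so \<open>approach\<close>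
  never raises them, and their sum drops until both knights are on the ring.\<close>

lemma winning_nonzero:
  assumes "x \<noteq> 0" "y \<noteq> 0"
  shows "winning x y z"
  using assms
proof (induction "nat (sup_norm x + sup_norm y)" arbitrary: x y z rule: less_induct)
  case (less x y z)
  have pos: "sup_norm u \<ge> 1" if "u \<noteq> 0" for u
    using that sup_norm_nonneg[of u] sup_norm_eq_0_iff[of u] by linarith
  show ?case
  proof (cases "sup_norm x = 1 \<and> sup_norm y = 1")
    case True
    then show ?thesis using winning_ring by (simp add: sup_norm_eq_1_iff)
  next
    case False
    show ?thesis
    proof (rule winningI)
      fix e assume e: "e \<in> set ((0, 0) # foot_steps)"
      obtain x' where x': "reply e x x'" "sup_norm x' \<le> max 1 (sup_norm x - 1)"
        using approach[OF e] by blast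
      obtain y' where y': "reply e y y'" "sup_norm y' \<le> max 1 (sup_norm y - 1)"
        using approach[OF e] by blast
      have "nat (sup_norm x' + sup_norm y') < nat (sup_norm x + sup_norm y)"
        using x'(2) y'(2) pos[OF less.prems(1)] pos[OF less.prems(2)] False by linarith
      then have "x' = 0 \<or> y' = 0 \<or> winning x' y' (z - e)"
        using less.hyps by blast
      then show "\<exists>x' y' z'. reply e x x' \<and> reply e y y' \<and> reply e z z' \<and>
          (x' = 0 \<or> y' = 0 \<or> z' = 0 \<or> winning x' y' z')"
        using x'(1) y'(1) reply_stay(1) by blast
    qed
  qed
qed

lemma plane_catch:
  "\<exists>m. cops_catch (plane_moves knight_steps) (plane_moves foot_steps) 3 m (\<lambda>_. 0) r"
proof (cases "r = 0")
  case True
  have "cops_catch (plane_moves knight_steps) (plane_moves foot_steps) 3 (Suc 0) (\<lambda>_. 0) r"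
    by (rule cops_catch_if_occupied[of 0]) (use True in simp_all)
  then show ?thesis ..
next
  case False
  have "winning (- r) (- r) (- r)" using False by (simp add: winning_nonzero)
  moreover have "triple (r + - r) (r + - r) (r + - r) = (\<lambda>_. 0)"
    by (auto simp: triple_def)
  \<comment> \<open>\<open>winning\<close> has the robber to move; the cops' opening turn is the
    case in which he stays.\<close>
  ultimately show ?thesis
    unfolding winning_def by (metis legal_turn_def)
qed

section \<open>The torus\<close>

definition torus_proj :: "nat \<Rightarrow> int \<times> int \<Rightarrow> int \<times> int" where
  "torus_proj n u = (fst u mod int n, snd u mod int n)"

lemma torus_proj_id: "u \<in> torus_verts n \<Longrightarrow> torus_proj n u = u"
  by (auto simp: torus_verts_def torus_proj_def)

lemma legal_turn_project:
  assumes "A' (p u) = p ` A u"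
  shows "legal_turn A' (p u) v' \<longleftrightarrow> (\<exists>v. legal_turn A u v \<and> p v = v')"
  using assms by (auto simp: legal_turn_def)

text \<open>Read from the plane to the torus, this projects the knights' moves; read backwards, it
  writes an attack on the torus as a knight step in the plane.\<close>

lemma knight_turn_project:
  "legal_turn (knight_moves n) (torus_proj n u) v' \<longleftrightarrow>
    (\<exists>v. plane_turn knight_steps u v \<and> torus_proj n v = v')"
proof (rule legal_turn_project)
  have "knight_moves n (torus_proj n u) = {torus_proj n (fst u + a, snd u + b) | a b.
      a \<in> {1, -1} \<and> b \<in> {2, -2} \<or> a \<in> {2, -2} \<and> b \<in> {1, -1}}"
    by (simp add: knight_moves_def torus_proj_def mod_add_left_eq)
  also have "\<dots> = torus_proj n ` {(fst u + a, snd u + b) | a b.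
      a \<in> {1, -1} \<and> b \<in> {2, -2} \<or> a \<in> {2, -2} \<and> b \<in> {1, -1}}"
    by blast
  also have "{(fst u + a, snd u + b) | a b.
      a \<in> {1, -1} \<and> b \<in> {2, -2} \<or> a \<in> {2, -2} \<and> b \<in> {1, -1}} = plane_moves knight_steps u"
    by (cases u) (auto simp: plane_moves_def knight_steps_def)
  finally show "knight_moves n (torus_proj n u) = torus_proj n ` plane_moves knight_steps u" .
qed

lemma foot_turn_project:
  assumes "n > 0"
  shows "legal_turn (foot_moves n) (torus_proj n u) v' \<longleftrightarrow>
    (\<exists>v. plane_turn foot_steps u v \<and> torus_proj n v = v')"
proof (rule legal_turn_project, intro set_eqI iffI)
  fix v assume "v \<in> torus_proj n ` plane_moves foot_steps u"
  then show "v \<in> foot_moves n (torus_proj n u)"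
    using assms
    by (cases u) (auto simp: plane_moves_def foot_steps_def foot_moves_def torus_adj_def
        torus_verts_def torus_proj_def differ_by_one_def mod_simps)
next
  fix v assume "v \<in> foot_moves n (torus_proj n u)"
  then have "\<exists>d \<in> set foot_steps. v = torus_proj n (u + d)"
    by (cases u; cases v) (auto simp: foot_steps_def foot_moves_def torus_adj_def
        torus_verts_def torus_proj_def differ_by_one_def mod_simps)
  then show "v \<in> torus_proj n ` plane_moves foot_steps u"
    unfolding plane_moves_def by blast
qed

lemma three_knights_win:
  assumes "n > 0"
  shows "cops_win (torus_verts n) (knight_moves n) (foot_moves n) 3"
proof (rule cops_win_if_catch[where ?c0.0 = "\<lambda>_. 0"])
  show "(0 :: int \<times> int) \<in> torus_verts n"
    using assms by (simp add: torus_verts_def zero_prod_def)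
next
  fix r assume r: "r \<in> torus_verts n"
  obtain m where "cops_catch (plane_moves knight_steps) (plane_moves foot_steps) 3 m (\<lambda>_. 0) r"
    using plane_catch by blast
  then have "cops_catch (knight_moves n) (foot_moves n) 3 m (\<lambda>_. torus_proj n 0) (torus_proj n r)"
    by (rule cops_catch_project[rotated 2])
      (use knight_turn_project foot_turn_project[OF assms] in blast)+
  moreover have "torus_proj n 0 = 0"
    by (simp add: torus_proj_def zero_prod_def)
  ultimately show "\<exists>m. cops_catch (knight_moves n) (foot_moves n) 3 m (\<lambda>_. 0) r"
    using torus_proj_id[OF r] by auto
qed

section \<open>Two knights do not suffice on the torus\<close>

text \<open>Each side amounts to \<open>x = 0\<close>. This replaces a large modulus by a fixed
  one.\<close>

lemma dvd_small_iff:
  fixes x :: int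
  assumes "\<bar>x\<bar> < int N" "N \<le> n"
  shows "int n dvd x \<longleftrightarrow> int N dvd x"
  using assms zdvd_not_zless[of "\<bar>x\<bar>"] by (cases "x = 0") (auto simp: not_less dest!: zdvd_imp_le[of _ "\<bar>x\<bar>"])

definition torus_zero :: "int \<Rightarrow> int \<times> int \<Rightarrow> bool" where
  "torus_zero n u \<longleftrightarrow> fst u mod n = 0 \<and> snd u mod n = 0"

lemma torus_proj_eq_iff: "torus_proj n u = torus_proj n v \<longleftrightarrow> torus_zero (int n) (u - v)"
  by (simp add: torus_proj_def torus_zero_def mod_eq_dvd_iff dvd_eq_mod_eq_0[symmetric])

text \<open>A knight attacking one of the five squares is at distance at most 3 from the centre in each
  coordinate, so all differences that occur have coordinates of absolute value at most 6, and the
  cases \<open>n \<ge> 7\<close> look alike.\<close>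

lemma knight_covers_two:
  assumes n: "n \<ge> 5" and c: "c \<in> torus_verts n" and r: "r \<in> torus_verts n" and "c \<noteq> r"
  shows "card {e \<in> set ((0, 0) # foot_steps).
    legal_turn (knight_moves n) c (torus_proj n (r + e))} \<le> 2" (is "card ?T \<le> 2")
proof -
  let ?E = "(0, 0) # foot_steps" and ?K = "(0, 0) # knight_steps"
  have turn: "legal_turn (knight_moves n) c (torus_proj n (r + e)) \<longleftrightarrow>
      (\<exists>k \<in> set ?K. torus_zero (int n) (e - k - (c - r)))" for e
  proof -
    have "legal_turn (knight_moves n) c (torus_proj n (r + e)) \<longleftrightarrow>
        (\<exists>v. v - c \<in> set ?K \<and> torus_proj n v = torus_proj n (r + e))"
      using knight_turn_project[of n c "torus_proj n (r + e)"]
      unfolding torus_proj_id[OF c] plane_turn_iff .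
    also have "\<dots> \<longleftrightarrow> (\<exists>k \<in> set ?K. torus_proj n (r + e) = torus_proj n (c + k))"
      by (metis add_diff_cancel_left' diff_add_cancel add.commute)
    also have "\<dots> \<longleftrightarrow> (\<exists>k \<in> set ?K. torus_zero (int n) (e - k - (c - r)))"
      unfolding torus_proj_eq_iff by (simp add: algebra_simps)
    finally show ?thesis .
  qed
  show ?thesis
  proof (cases "?T = {}")
    case False
    then obtain e0 k0 where e0: "e0 \<in> set ?E" and k0: "k0 \<in> set ?K"
      and zero: "torus_zero (int n) (e0 - k0 - (c - r))"
      using turn by blast
    \<comment> \<open>Any attacked square yields a representative \<open>d\<close> of
      \<open>c - r\<close> modulo \<open>n\<close> that ranges over finitely many values independent
      of \<open>n\<close>.\<close>
    define d where "d = e0 - k0"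
    define N where "N = min n 7"
    have shift: "torus_zero (int n) (u - (c - r)) \<longleftrightarrow> torus_zero (int n) (u - d)" for u
    proof -
      have "torus_proj n d = torus_proj n (c - r)"
        using zero unfolding torus_proj_eq_iff d_def .
      then show ?thesis unfolding torus_proj_eq_iff[symmetric] by simp
    qed
    have "d \<noteq> 0"
    proof
      assume "d = 0"
      then have "torus_proj n r = torus_proj n c"
        using zero unfolding torus_proj_eq_iff d_def by simp
      then show False using \<open>c \<noteq> r\<close> torus_proj_id c r by metis
    qed
    have small: "torus_zero (int n) (e - k - d) \<longleftrightarrow> torus_zero (int N) (e - k - d)"
      if "e \<in> set ?E" "k \<in> set ?K" for e k
    proof -
      have E: "\<bar>fst e\<bar> + \<bar>snd e\<bar> \<le> 1" if "e \<in> set ?E" for e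
        using that by (auto simp: foot_steps_def)
      have K: "\<bar>fst k\<bar> \<le> 2 \<and> \<bar>snd k\<bar> \<le> 2" if "k \<in> set ?K" for k
        using that by (auto simp: knight_steps_def)
      have "\<bar>fst (e - k - d)\<bar> < 7" "\<bar>snd (e - k - d)\<bar> < 7"
        using E[OF that(1)] K[OF that(2)] E[OF e0] K[OF k0] unfolding d_def fst_diff snd_diff
        by linarith+
      then show ?thesis
        using dvd_small_iff[of _ 7 n]
        by (cases "n \<le> 7") (auto simp: N_def torus_zero_def dvd_eq_mod_eq_0[symmetric] min_def)
    qed
    let ?F = "filter (\<lambda>e. \<exists>k \<in> set ?K. torus_zero (int N) (e - k - d)) ?E"
    \<comment> \<open>The moduli 5 and 6 are checked separately since wrap-around can matter there;
      7 stands for all larger ones. The excluded case is \<open>d = 0\<close>, that is,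
      \<open>c = r\<close>.\<close>
    have "\<forall>N \<in> set [5, 6, 7]. \<forall>e0 \<in> set ?E. \<forall>k0 \<in> set ?K. e0 - k0 = (0, 0) \<or>
        length (filter (\<lambda>e. \<exists>k \<in> set ?K. torus_zero N (e - k - (e0 - k0))) ?E) \<le> 2"
      by code_simp
    moreover have "int N \<in> set [5, 6, 7]" using n by (auto simp: N_def)
    ultimately have length: "length ?F \<le> 2"
      using e0 k0 \<open>d \<noteq> 0\<close> unfolding d_def zero_prod_def by blast
    have "?T = set ?F"
      unfolding turn shift set_filter using small by blast
    then have "card ?T \<le> length ?F" by (simp only: card_length)
    then show ?thesis using length by (rule le_trans)
  next
    case True
    then show ?thesis by (simp only: card.empty)
  qed
qed

lemma two_knights_lose:
  assumes n: "n \<ge> 5" and k: "k \<le> 2"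
  shows "\<not> cops_win (torus_verts n) (knight_moves n) (foot_moves n) k"
proof (rule not_cops_win_if_evade)
  fix u v assume "u \<in> torus_verts n" "legal_turn (knight_moves n) u v"
  then show "v \<in> torus_verts n"
    using n by (auto simp: legal_turn_def knight_moves_def torus_verts_def)
next
  fix u v assume "u \<in> torus_verts n" "legal_turn (foot_moves n) u v"
  then show "v \<in> torus_verts n"
    by (auto simp: legal_turn_def foot_moves_def torus_adj_def)
next
  fix c :: "nat \<Rightarrow> int \<times> int"
  \<comment> \<open>Three distinct vertices cannot all be occupied by at most two knights.\<close>
  have "card (c ` {..<k}) < card {(0 :: int, 0 :: int), (0, 1), (0, 2)}"
    using k card_image_le[of "{..<k}" c] by simp
  moreover have "{(0, 0), (0, 1), (0, 2)} \<subseteq> torus_verts n"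
    using n by (auto simp: torus_verts_def)
  ultimately have "\<not> torus_verts n \<subseteq> c ` {..<k}"
    by (meson card_mono finite_imageI finite_lessThan leD order_trans)
  then obtain r where "r \<in> torus_verts n" "r \<notin> c ` {..<k}"
    unfolding subset_iff by blast
  then show "\<exists>r\<in>torus_verts n. \<forall>i<k. c i \<noteq> r"
    by (intro bexI[of _ r]) auto
next
  fix c :: "nat \<Rightarrow> int \<times> int" and r
  assume r: "r \<in> torus_verts n" and c: "\<And>i. i < k \<Longrightarrow> c i \<in> torus_verts n"
    and neq: "\<And>i. i < k \<Longrightarrow> c i \<noteq> r"
  let ?E = "set ((0, 0) # foot_steps)"
  \<comment> \<open>Steps are counted instead of torus squares, so the five options are distinct by
    inspection. At most two knights exclude at most four of them.\<close>
  define T where "T = (\<lambda>i. {e \<in> ?E. legal_turn (knight_moves n) (c i) (torus_proj n (r + e))})"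
  have "card (\<Union>i<k. T i) \<le> (\<Sum>i<k. card (T i))"
    by (rule card_UN_le) simp
  also have "\<dots> \<le> (\<Sum>i<k. 2)"
    unfolding T_def by (intro sum_mono knight_covers_two n c r neq) simp_all
  also have "\<dots> < card ?E"
    using k by (simp add: foot_steps_def)
  finally have "\<not> ?E \<subseteq> (\<Union>i<k. T i)"
    using card_mono[of "\<Union>i<k. T i" ?E] by (auto simp: T_def)
  then obtain e where e: "e \<in> ?E" and safe: "\<And>i. i < k \<Longrightarrow> e \<notin> T i"
    by blast
  have n_pos: "n > 0" using n by simp
  have "plane_turn foot_steps r (r + e)"
    using e by (simp add: plane_turn_iff)
  then have "legal_turn (foot_moves n) r (torus_proj n (r + e))"
    unfolding foot_turn_project[OF n_pos, of r, unfolded torus_proj_id[OF r]] by blast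
  then show "\<exists>r'. legal_turn (foot_moves n) r r' \<and> (\<forall>i<k. \<not> legal_turn (knight_moves n) (c i) r')"
    using e safe unfolding T_def by blast
qed

theorem theorem2:
  fixes n :: nat
  assumes "n \<ge> 5"
  shows "cop_number (torus_verts n) (knight_moves n) (foot_moves n) = 3"
  unfolding cop_number_def
proof (rule Least_equality)
  show "cops_win (torus_verts n) (knight_moves n) (foot_moves n) 3"
    using assms by (simp add: three_knights_win)
next
  fix k assume "cops_win (torus_verts n) (knight_moves n) (foot_moves n) k"
  then show "3 \<le> k"
    using two_knights_lose[OF assms, of k] by linarith
qed

end
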